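(* Let $\phi:(M,g)\to\mathbb{C}$ be a complex-valued function on a semi-Riemannian manifold and let $(\lambda,\mu)\in\mathbb{C}^2\setminus\{0\}$ be such that the tension field $\tau$ and the conformality operator $\kappa$ satisfy $$\tau(\phi)=\lambda\cdot\phi\quad\text{and}\quad \kappa(\phi,\phi)=\mu\cdot\phi^2.$$ Then for any positive integer $p$ the non-vanishing function $$\Phi_p:W=\{x\in M\mid \phi(x)\notin(-\infty,0]\}\to\mathbb{C}$$ with $$\Phi_p(x)=\begin{cases} c_1\cdot\log(\phi(x))^{p-1}, & \text{if } \mu=0,\ \lambda\neq 0,\\ c_1\cdot\log(\phi(x))^{2p-1}+c_2\cdot\log(\phi(x))^{2p-2}, & \text{if } \mu\neq 0,\ \lambda=\mu,\\ c_1\cdot\phi(x)^{1-\frac{\lambda}{\mu}}\log(\phi(x))^{p-1}+c_2\cdot\log(\phi(x))^{p-1}, & \text{if } \mu\neq 0,\ \lambda\neq\mu,\end{cases}$$ is a proper $p$-harmonic function. Here $c_1,c_2$ are complex coefficients, not both zero.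
   Context: For a semi-Riemannian manifold $(M,g)$ the metric is extended to a complex-bilinear form on the complexified tangent bundle. For complex-valued functions $\phi,\psi$ on $M$, the Laplace-Beltrami operator (tension field) is $\tau(\phi)=\operatorname{div}(\nabla\phi)$ and the complex-bilinear conformality operator is $\kappa(\phi,\psi)=g(\nabla\phi,\nabla\psi)$, which in local coordinates is $\sum_{i,j}g^{ij}\frac{\partial\phi}{\partial x_i}\frac{\partial\psi}{\partial x_j}$. The iterated Laplace-Beltrami operator is given by $\tau^0(\phi)=\phi$ and $\tau^p(\phi)=\tau(\tau^{p-1}(\phi))$ for positive integers $p$. A complex-valued function $\phi$ is proper $p$-harmonic if $\tau^p(\phi)=0$ and $\tau^{p-1}(\phi)$ does not vanish identically. Here $\log$ is the principal branch of the logarithm on $\mathbb{C}\setminus(-\infty,0]$, $\log(\phi(x))^{k}$ means $(\log(\phi(x)))^{k}$, and $\phi^{s}=\exp(s\log\phi)$. *)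

theory Defs
  imports "HOL-Analysis.Analysis"
begin

section \<open>Smooth maps on open sets of normed spaces\<close>

text \<open>
  Only meaningful for open \<open>S\<close> in a finite-dimensional space: \<open>f\<close> is of class \<open>C\<^sup>k\<close> if all
  its iterated directional derivatives up to order \<open>k\<close> exist and are continuous.
\<close>

primrec Ck_on :: "nat \<Rightarrow> 'a::real_normed_vector set \<Rightarrow> ('a \<Rightarrow> 'b::real_normed_vector) \<Rightarrow> bool" where
  "Ck_on 0 S f \<longleftrightarrow> continuous_on S f"
| "Ck_on (Suc k) S f \<longleftrightarrow>
     (\<forall>x\<in>S. f differentiable (at x)) \<and> (\<forall>v. Ck_on k S (\<lambda>x. frechet_derivative f (at x) v))"

definition smooth_on :: "'a::real_normed_vector set \<Rightarrow> ('a \<Rightarrow> 'b::real_normed_vector) \<Rightarrow> bool" where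
  "smooth_on S f \<longleftrightarrow> (\<forall>k. Ck_on k S f)"


section \<open>Smooth manifolds\<close>

text \<open>A chart is a pair \<open>(U, x)\<close> of its domain and its coordinate map, the latter relevant on
  \<open>U\<close> only.\<close>

type_synonym ('a, 'n) chart = "'a set \<times> ('a \<Rightarrow> real^'n)"

definition chart_image :: "('a, 'n::finite) chart \<Rightarrow> (real^'n) set" where
  "chart_image c = snd c ` fst c"

definition chart_inv :: "('a, 'n::finite) chart \<Rightarrow> real^'n \<Rightarrow> 'a" where
  "chart_inv c = inv_into (fst c) (snd c)"

locale smooth_manifold =
  fixes M :: "'a topology" and A :: "('a, 'n::finite) chart set"
  assumes Hausdorff: "Hausdorff_space M"
    and second_countable: "second_countable M"
    and chart_domain: "c \<in> A \<Longrightarrow> openin M (fst c)"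
    and chart_open: "c \<in> A \<Longrightarrow> open (chart_image c)"
    and chart_homeo: "c \<in> A \<Longrightarrow>
      homeomorphic_map (subtopology M (fst c)) (top_of_set (chart_image c)) (snd c)"
    and charts_cover: "(\<Union>c\<in>A. fst c) = topspace M"
    and charts_compatible: "c \<in> A \<Longrightarrow> d \<in> A \<Longrightarrow>
      smooth_on (snd c ` (fst c \<inter> fst d)) (snd d \<circ> chart_inv c)"

definition smooth_fun_on ::
  "('a, 'n::finite) chart set \<Rightarrow> 'a set \<Rightarrow> ('a \<Rightarrow> 'b::real_normed_vector) \<Rightarrow> bool" where
  "smooth_fun_on A W f \<longleftrightarrow> (\<forall>c\<in>A. smooth_on (snd c ` (fst c \<inter> W)) (f \<circ> chart_inv c))"

text \<open>The coordinate derivative \<open>\<partial>f/\<partial>x\<^sub>i\<close> in the chart \<open>c\<close> at the point \<open>p\<close>.\<close>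

definition coord_deriv ::
  "('a, 'n::finite) chart \<Rightarrow> 'n \<Rightarrow> ('a \<Rightarrow> 'b::real_normed_vector) \<Rightarrow> 'a \<Rightarrow> 'b" where
  "coord_deriv c i f p = frechet_derivative (f \<circ> chart_inv c) (at (snd c p)) (axis i 1)"


section \<open>Semi-Riemannian metrics\<close>

text \<open>
  The metric is a covariant 2-tensor field given by its component matrices \<open>g\<^sub>i\<^sub>j\<close> in the charts,
  which are subject to the transformation law of such a tensor: \<open>g c p\<close> is the matrix of the
  components at \<open>p\<close> with respect to the chart \<open>c\<close>, of interest for \<open>p\<close> in the domain of \<open>c\<close> only.
  No condition is imposed on the index.
\<close>

type_synonym ('a, 'n) metric = "('a, 'n) chart \<Rightarrow> 'a \<Rightarrow> real^'n^'n"

locale semi_riemannian_manifold = smooth_manifold M A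
  for M :: "'a topology" and A :: "('a, 'n::finite) chart set" +
  fixes g :: "('a, 'n) metric"
  assumes metric_smooth: "c \<in> A \<Longrightarrow> smooth_on (chart_image c) (g c \<circ> chart_inv c)"
    and metric_symmetric: "c \<in> A \<Longrightarrow> p \<in> fst c \<Longrightarrow> transpose (g c p) = g c p"
    and metric_nondegenerate: "c \<in> A \<Longrightarrow> p \<in> fst c \<Longrightarrow>
      (\<forall>v. u \<bullet> (g c p *v v) = 0) \<Longrightarrow> u = 0"
    and metric_transform: "c \<in> A \<Longrightarrow> d \<in> A \<Longrightarrow> p \<in> fst c \<Longrightarrow> p \<in> fst d \<Longrightarrow>
      J = jacobian (snd d \<circ> chart_inv c) (at (snd c p)) \<Longrightarrow>
      g c p = transpose J ** g d p ** J"


section \<open>Gradient, divergence, tension field and conformality operator\<close>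

text \<open>
  Complex vector fields near a point are given by their components with respect to the
  coordinate frame of a chart.
\<close>

definition metric_bilinear :: "real^'n^'n \<Rightarrow> complex^'n \<Rightarrow> complex^'n \<Rightarrow> complex" where
  "metric_bilinear G X Y = (\<Sum>i\<in>UNIV. \<Sum>j\<in>UNIV. of_real (G $ i $ j) * X $ i * Y $ j)"

definition gradient ::
  "('a, 'n::finite) metric \<Rightarrow> ('a, 'n) chart \<Rightarrow> ('a \<Rightarrow> complex) \<Rightarrow> 'a \<Rightarrow> complex^'n" where
  "gradient g c f p = (\<chi> i. \<Sum>j\<in>UNIV. of_real (matrix_inv (g c p) $ i $ j) * coord_deriv c j f p)"

text \<open>The Christoffel symbol \<open>\<Gamma>\<^sup>k\<^sub>i\<^sub>j\<close> of the Levi-Civita connection.\<close>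

definition christoffel ::
  "('a, 'n::finite) metric \<Rightarrow> ('a, 'n) chart \<Rightarrow> 'a \<Rightarrow> 'n \<Rightarrow> 'n \<Rightarrow> 'n \<Rightarrow> real" where
  "christoffel g c p k i j = (1/2) * (\<Sum>l\<in>UNIV. matrix_inv (g c p) $ k $ l *
     (coord_deriv c i (\<lambda>q. g c q $ j $ l) p + coord_deriv c j (\<lambda>q. g c q $ i $ l) p
      - coord_deriv c l (\<lambda>q. g c q $ i $ j) p))"

text \<open>The divergence of \<open>X\<close> is the trace of its covariant derivative \<open>\<nabla>X\<close>.\<close>

definition divergence ::
  "('a, 'n::finite) metric \<Rightarrow> ('a, 'n) chart \<Rightarrow> ('a \<Rightarrow> complex^'n) \<Rightarrow> 'a \<Rightarrow> complex" where
  "divergence g c X p = (\<Sum>i\<in>UNIV. coord_deriv c i (\<lambda>q. X q $ i) p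
     + (\<Sum>k\<in>UNIV. of_real (christoffel g c p i i k) * X p $ k))"

text \<open>
  Both operators below are evaluated at \<open>p\<close> in some chart around \<open>p\<close>; by the transformation law
  of the metric their values on smooth functions do not depend on which one is used.
\<close>

definition chart_at :: "('a, 'n::finite) chart set \<Rightarrow> 'a \<Rightarrow> ('a, 'n) chart" where
  "chart_at A p = (SOME c. c \<in> A \<and> p \<in> fst c)"

definition tension ::
  "('a, 'n::finite) chart set \<Rightarrow> ('a, 'n) metric \<Rightarrow> ('a \<Rightarrow> complex) \<Rightarrow> 'a \<Rightarrow> complex" where
  "tension A g f p = (let c = chart_at A p in divergence g c (gradient g c f) p)"

definition conformality ::
  "('a, 'n::finite) chart set \<Rightarrow> ('a, 'n) metric \<Rightarrow> ('a \<Rightarrow> complex) \<Rightarrow> ('a \<Rightarrow> complex)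
     \<Rightarrow> 'a \<Rightarrow> complex" where
  "conformality A g f h p = (let c = chart_at A p in
     metric_bilinear (g c p) (gradient g c f p) (gradient g c h p))"

text \<open>
  For an open subset \<open>W\<close> of the manifold. As the operators are local, the values of the total
  function \<open>f\<close> outside \<open>W\<close> are irrelevant.
\<close>

definition proper_p_harmonic_on ::
  "('a, 'n::finite) chart set \<Rightarrow> ('a, 'n) metric \<Rightarrow> 'a set \<Rightarrow> nat \<Rightarrow> ('a \<Rightarrow> complex) \<Rightarrow> bool" where
  "proper_p_harmonic_on A g W p f \<longleftrightarrow>
     smooth_fun_on A W f \<and>
     (\<forall>x\<in>W. (tension A g ^^ p) f x = 0) \<and>
     (\<exists>x\<in>W. (tension A g ^^ (p - 1)) f x \<noteq> 0)"

end

theory Submission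
  imports Defs "HOL-Complex_Analysis.Cauchy_Integral_Formula" "HOL-Computational_Algebra.Polynomial"
begin

text \<open>
  For holomorphic \<open>F\<close> the chain rule gives
  \<open>\<tau>(F \<circ> u) = F'(u) \<tau>(u) + F''(u) \<kappa>(u,u)\<close> and \<open>\<kappa>(F \<circ> u, F \<circ> u) = F'(u)\<^sup>2 \<kappa>(u,u)\<close>.
  Hence \<open>u = log \<phi>\<close> has constant \<open>\<tau>(u) = \<lambda> - \<mu>\<close> and \<open>\<kappa>(u,u) = \<mu>\<close>, so that on functions of \<open>u\<close> the
  tension field is the constant coefficient operator \<open>\<mu> D\<^sup>2 + (\<lambda> - \<mu>) D\<close>. Each \<open>\<Phi>\<^sub>p\<close> has the form
  \<open>exp(a u) P(u) + Q(u)\<close> with \<open>exp(a u)\<close> in the kernel of this operator, which therefore acts on the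
  polynomials \<open>P\<close> and \<open>Q\<close> separately and lowers their degrees. That \<open>\<tau>\<^sup>p\<^sup>-\<^sup>1(\<Phi>\<^sub>p)\<close> does not vanish
  identically when \<open>\<mu> \<noteq> 0\<close> follows from the formula for \<open>\<kappa>\<close>: if \<open>F \<circ> u\<close> is constant, then
  \<open>F'(u)\<^sup>2 \<mu> = 0\<close>.
\<close>

section \<open>Functions of class \<open>C\<^sup>k\<close>\<close>

lemma Ck_on_imp_continuous_on:
  assumes "Ck_on k S f"
  shows "continuous_on S f"
proof (cases k)
  case 0
  then show ?thesis using assms by simp
next
  case (Suc n)
  then have "f differentiable (at x)" if "x \<in> S" for x
    using assms that by simp
  then show ?thesis
    by (intro continuous_at_imp_continuous_on ballI differentiable_imp_continuous_within)
qed

lemma Ck_on_SucD: "Ck_on (Suc k) S f \<Longrightarrow> Ck_on k S f"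
proof (induction k arbitrary: f)
  case 0
  then show ?case using Ck_on_imp_continuous_on[OF 0] by simp
next
  case (Suc k)
  then show ?case by simp
qed

lemma Ck_on_subset: "Ck_on k S f \<Longrightarrow> T \<subseteq> S \<Longrightarrow> Ck_on k T f"
  by (induction k arbitrary: f) (auto intro: continuous_on_subset)

lemma frechet_derivative_cong_open:
  assumes "open S" "x \<in> S" "\<And>y. y \<in> S \<Longrightarrow> f y = h y"
  shows "frechet_derivative f (at x) = frechet_derivative h (at x)"
proof -
  \<comment> \<open>\<open>frechet_derivative\<close> is a choice among all derivatives, so it
    suffices that both functions have the same ones. This also covers functions that are not
    differentiable at \<open>x\<close>.\<close>
  have "(f has_derivative f') (at x) \<longleftrightarrow> (h has_derivative f') (at x)" for f'
    using has_derivative_transform_within_open[of f f' x UNIV S h]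
      has_derivative_transform_within_open[of h f' x UNIV S f] assms by auto
  then show ?thesis
    by (simp add: frechet_derivative_def)
qed

lemma differentiable_cong_open:
  assumes "open S" "x \<in> S" "\<And>y. y \<in> S \<Longrightarrow> f y = h y" "f differentiable (at x)"
  shows "h differentiable (at x)"
  using assms has_derivative_transform_within_open[of f _ x UNIV S h]
  unfolding differentiable_def by blast

text \<open>On an open set, derivatives see only the values in the set, so agreement passes to all
  iterated derivatives. A derivative can thus be replaced by the formula that the product or chain
  rule gives for it.\<close>

lemma Ck_on_cong:
  assumes "open S" "\<And>x. x \<in> S \<Longrightarrow> f x = h x" "Ck_on k S f"
  shows "Ck_on k S h"
  using assms(2,3)
proof (induction k arbitrary: f h)
  case 0
  then show ?case using continuous_on_cong by force
next
  case (Suc k)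
  have "h differentiable (at x)" if "x \<in> S" for x
    using Suc.prems that assms(1) differentiable_cong_open[of S x f h] by auto
  moreover have "Ck_on k S (\<lambda>x. frechet_derivative h (at x) v)" for v
  proof (rule Suc.IH)
    show "Ck_on k S (\<lambda>x. frechet_derivative f (at x) v)"
      using Suc.prems(2) by simp
    show "frechet_derivative f (at x) v = frechet_derivative h (at x) v" if "x \<in> S" for x
      using frechet_derivative_cong_open[OF assms(1) that Suc.prems(1)] by simp
  qed
  ultimately show ?case by simp
qed

lemma Ck_on_add:
  assumes "open S" "Ck_on k S f" "Ck_on k S h"
  shows "Ck_on k S (\<lambda>x. f x + h x)"
  using assms(2,3)
proof (induction k arbitrary: f h)
  case 0
  then show ?case by (auto intro: continuous_intros)
next
  case (Suc k)
  have "Ck_on k S (\<lambda>x. frechet_derivative (\<lambda>x. f x + h x) (at x) v)" for v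
  proof (rule Ck_on_cong[OF assms(1) _ Suc.IH])
    show "Ck_on k S (\<lambda>x. frechet_derivative f (at x) v)"
      and "Ck_on k S (\<lambda>x. frechet_derivative h (at x) v)"
      using Suc.prems by auto
    fix x assume "x \<in> S"
    then have fh: "(f has_derivative frechet_derivative f (at x)) (at x)"
      "(h has_derivative frechet_derivative h (at x)) (at x)"
      using Suc.prems by (auto simp: frechet_derivative_works)
    show "frechet_derivative f (at x) v + frechet_derivative h (at x) v
        = frechet_derivative (\<lambda>x. f x + h x) (at x) v"
      using fun_cong[OF frechet_derivative_at[OF has_derivative_add[OF fh]], of v] by simp
  qed
  moreover have "\<forall>x\<in>S. (\<lambda>x. f x + h x) differentiable (at x)"
    using Suc.prems by simp
  ultimately show ?case by simp
qed

lemma Ck_on_mult: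
  fixes f h :: "'a::real_normed_vector \<Rightarrow> 'b::real_normed_algebra"
  assumes "open S" "Ck_on k S f" "Ck_on k S h"
  shows "Ck_on k S (\<lambda>x. f x * h x)"
  using assms(2,3)
proof (induction k arbitrary: f h)
  case 0
  then show ?case by (auto intro: continuous_intros)
next
  case (Suc k)
  have "Ck_on k S (\<lambda>x. frechet_derivative (\<lambda>x. f x * h x) (at x) v)" for v
  proof (rule Ck_on_cong[OF assms(1)])
    show "Ck_on k S (\<lambda>x. f x * frechet_derivative h (at x) v + frechet_derivative f (at x) v * h x)"
      using Suc.prems Ck_on_SucD[OF Suc.prems(1)] Ck_on_SucD[OF Suc.prems(2)]
      by (intro Ck_on_add[OF assms(1)] Suc.IH) auto
    fix x assume "x \<in> S"
    then have fh: "(f has_derivative frechet_derivative f (at x)) (at x)"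
      "(h has_derivative frechet_derivative h (at x)) (at x)"
      using Suc.prems by (auto simp: frechet_derivative_works)
    show "f x * frechet_derivative h (at x) v + frechet_derivative f (at x) v * h x
        = frechet_derivative (\<lambda>x. f x * h x) (at x) v"
      using fun_cong[OF frechet_derivative_at[OF has_derivative_mult[OF fh]], of v] by simp
  qed
  moreover have "\<forall>x\<in>S. (\<lambda>x. f x * h x) differentiable (at x)"
    using Suc.prems by simp
  ultimately show ?case by simp
qed

lemma frechet_derivative_holomorphic_compose:
  fixes v :: "'a::real_normed_vector \<Rightarrow> complex"
  assumes "F holomorphic_on T" "open T" "v x \<in> T" "v differentiable (at x)"
  shows "(\<lambda>x. F (v x)) differentiable (at x)"
    and "frechet_derivative (\<lambda>x. F (v x)) (at x) w = deriv F (v x) * frechet_derivative v (at x) w"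
proof -
  have "(F has_derivative (\<lambda>z. deriv F (v x) * z)) (at (v x))"
    using holomorphic_derivI[OF assms(1-3)] by (simp add: has_field_derivative_def)
  from has_derivative_compose[OF assms(4)[unfolded frechet_derivative_works] this]
  have *: "((\<lambda>x. F (v x)) has_derivative (\<lambda>w. deriv F (v x) * frechet_derivative v (at x) w)) (at x)" .
  show "(\<lambda>x. F (v x)) differentiable (at x)"
    using * by (rule differentiableI)
  show "frechet_derivative (\<lambda>x. F (v x)) (at x) w = deriv F (v x) * frechet_derivative v (at x) w"
    using fun_cong[OF frechet_derivative_at[OF *], of w] by simp
qed

text \<open>The derivative in direction \<open>w\<close> is \<open>F'(v)\<close> times that of
  \<open>v\<close>, and \<open>F'\<close> is again holomorphic on \<open>T\<close>; hence the
  induction on \<open>k\<close> leaves \<open>F\<close> arbitrary.\<close>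

lemma Ck_on_holomorphic_compose:
  assumes "open S" "F holomorphic_on T" "open T" "v ` S \<subseteq> T" "Ck_on k S v"
  shows "Ck_on k S (\<lambda>x. F (v x))"
  using assms(2,5)
proof (induction k arbitrary: F)
  case 0
  then show ?case
    using continuous_on_compose2[OF holomorphic_on_imp_continuous_on] assms(4) by auto
next
  case (Suc k)
  have v: "v x \<in> T" "v differentiable (at x)" if "x \<in> S" for x
    using that assms(4) Suc.prems by auto
  have "Ck_on k S (\<lambda>x. frechet_derivative (\<lambda>x. F (v x)) (at x) w)" for w
  proof (rule Ck_on_cong[OF assms(1) _ Ck_on_mult[OF assms(1) Suc.IH]])
    show "deriv F holomorphic_on T"
      using Suc.prems assms(3) by (simp add: holomorphic_deriv)
    show "Ck_on k S v"
      using Suc.prems Ck_on_SucD by blast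
    show "Ck_on k S (\<lambda>x. frechet_derivative v (at x) w)"
      using Suc.prems by auto
    show "deriv F (v x) * frechet_derivative v (at x) w = frechet_derivative (\<lambda>x. F (v x)) (at x) w"
      if "x \<in> S" for x
      using frechet_derivative_holomorphic_compose(2)[OF Suc.prems(1) assms(3) v[OF that]] by simp
  qed
  then show ?case
    using frechet_derivative_holomorphic_compose(1)[OF Suc.prems(1) assms(3) v] by simp
qed

section \<open>Differentiability of the inverse matrix\<close>

lemma differentiable_prod:
  fixes f :: "'i \<Rightarrow> 'a::real_normed_vector \<Rightarrow> real"
  assumes "finite I" "\<And>i. i \<in> I \<Longrightarrow> f i differentiable (at x)"
  shows "(\<lambda>x. \<Prod>i\<in>I. f i x) differentiable (at x)"
  using assms by (induction I rule: finite_induct) auto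

lemma differentiable_det:
  fixes B :: "'a::real_normed_vector \<Rightarrow> real^'n^'n"
  assumes "\<And>i j. (\<lambda>x. B x $ i $ j) differentiable (at x)"
  shows "(\<lambda>x. det (B x)) differentiable (at x)"
  unfolding det_def
  by (intro differentiable_sum differentiable_mult differentiable_prod ballI assms)
    (auto simp: finite_permutations)

lemma matrix_mult_matrix_inv:
  assumes "invertible B"
  shows "B ** matrix_inv B = mat 1"
  using someI_ex[OF assms[unfolded invertible_def]] by (simp add: matrix_inv_def)

text \<open>Column \<open>j\<close> of the inverse solves \<open>B *v x = axis j 1\<close>, and
  Cramer's rule gives the entries of that solution.\<close>

lemma matrix_inv_cramer:
  fixes B :: "real^'n^'n"
  assumes "invertible B"
  shows "matrix_inv B $ i $ j = det (\<chi> r s. if s = i then axis j 1 $ r else B $ r $ s) / det B"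
proof -
  have "B *v (matrix_inv B *v axis j 1) = axis j 1"
    using assms by (simp add: matrix_vector_mul_assoc matrix_mult_matrix_inv)
  then have "matrix_inv B *v axis j 1
      = (\<chi> k. det (\<chi> r s. if s = k then axis j 1 $ r else B $ r $ s) / det B)"
    using assms cramer[of B] by (simp add: invertible_det_nz)
  then have "(matrix_inv B *v axis j 1) $ i = det (\<chi> r s. if s = i then axis j 1 $ r else B $ r $ s) / det B"
    by simp
  then show ?thesis
    by (simp add: matrix_vector_mult_basis column_def)
qed

lemma differentiable_matrix_inv:
  fixes B :: "'a::real_normed_vector \<Rightarrow> real^'n^'n"
  assumes "open S" "x \<in> S" "\<And>y. y \<in> S \<Longrightarrow> invertible (B y)"
    and B: "\<And>i j. (\<lambda>x. B x $ i $ j) differentiable (at x)"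
  shows "(\<lambda>y. matrix_inv (B y) $ i $ j) differentiable (at x)"
proof (rule differentiable_cong_open[OF assms(1,2)])
  show "det (\<chi> r s. if s = i then axis j 1 $ r else B y $ r $ s) / det (B y) = matrix_inv (B y) $ i $ j"
    if "y \<in> S" for y
    using matrix_inv_cramer[OF assms(3)[OF that], of i j] by simp
  have "(\<lambda>y. det (\<chi> r s. if s = i then axis j 1 $ r else B y $ r $ s)) differentiable (at x)"
  proof (rule differentiable_det)
    fix r s
    show "(\<lambda>y. (\<chi> r s. if s = i then axis j 1 $ r else B y $ r $ s) $ r $ s) differentiable (at x)"
      using B by (cases "s = i") auto
  qed
  then show "(\<lambda>y. det (\<chi> r s. if s = i then axis j 1 $ r else B y $ r $ s) / det (B y)) differentiable (at x)"
    using assms(2,3) invertible_det_nz[of "B x"] differentiable_det[of B x] B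
    by (intro differentiable_divide) auto
qed

section \<open>Calculus in charts\<close>

context smooth_manifold
begin

lemma chart_inj: "c \<in> A \<Longrightarrow> inj_on (snd c) (fst c)"
  using homeomorphic_imp_injective_map[OF chart_homeo, of c]
  by (simp add: Int_absorb1 openin_subset chart_domain)

lemma chart_inv_chart: "c \<in> A \<Longrightarrow> x \<in> fst c \<Longrightarrow> chart_inv c (snd c x) = x"
  by (simp add: chart_inv_def chart_inj)

lemma open_chart_image_Int:
  assumes "c \<in> A" "openin M W"
  shows "open (snd c ` (fst c \<inter> W))"
proof -
  have "openin (subtopology M (fst c)) (fst c \<inter> W)"
    using assms openin_subtopology by (metis inf_commute)
  then have "openin (top_of_set (chart_image c)) (snd c ` (fst c \<inter> W))"
    using homeomorphic_imp_open_map[OF chart_homeo[OF assms(1)]] by (simp add: open_map_def)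
  then show ?thesis
    using chart_open[OF assms(1)] openin_open_trans by blast
qed

text \<open>The charts cover \<open>M\<close> and are homeomorphisms on open domains, so around each
  of its points \<open>W\<close> contains the open preimage of an open set of coordinates.\<close>

lemma openin_if_open_in_charts:
  assumes "W \<subseteq> topspace M" "\<And>c. c \<in> A \<Longrightarrow> open (snd c ` (fst c \<inter> W))"
  shows "openin M W"
proof (subst openin_subopen, intro ballI)
  fix x assume "x \<in> W"
  then obtain c where c: "c \<in> A" "x \<in> fst c"
    using assms(1) charts_cover by blast
  have sub: "topspace (subtopology M (fst c)) = fst c"
    using chart_domain[OF c(1)] openin_subset by (metis topspace_subtopology_subset)
  have "openin (top_of_set (chart_image c)) (snd c ` (fst c \<inter> W))"
    using assms(2)[OF c(1)] by (intro open_openin_trans chart_open c) (auto simp: chart_image_def)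
  then have "openin (subtopology M (fst c)) {q \<in> fst c. snd c q \<in> snd c ` (fst c \<inter> W)}"
    using openin_continuous_map_preimage[OF homeomorphic_imp_continuous_map[OF chart_homeo[OF c(1)]]]
    unfolding sub by blast
  moreover have "{q \<in> fst c. snd c q \<in> snd c ` (fst c \<inter> W)} = fst c \<inter> W"
    using chart_inj[OF c(1)] by (auto dest: inj_onD)
  ultimately have "openin M (fst c \<inter> W)"
    using openin_trans_full chart_domain[OF c(1)] by metis
  then show "\<exists>T. openin M T \<and> x \<in> T \<and> T \<subseteq> W"
    using c \<open>x \<in> W\<close> by blast
qed

lemma chart_at: "x \<in> topspace M \<Longrightarrow> chart_at A x \<in> A \<and> x \<in> fst (chart_at A x)"
  unfolding chart_at_def by (rule someI_ex) (use charts_cover in blast)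

lemma smooth_fun_on_holomorphic_compose:
  assumes "openin M W" "smooth_fun_on A W u" "F holomorphic_on T" "open T" "u ` W \<subseteq> T"
    and f: "\<And>x. x \<in> W \<Longrightarrow> f x = F (u x)"
  shows "smooth_fun_on A W f"
  unfolding smooth_fun_on_def smooth_on_def
proof (intro ballI allI)
  fix c k assume c: "c \<in> A"
  note o = open_chart_image_Int[OF c assms(1)]
  show "Ck_on k (snd c ` (fst c \<inter> W)) (f \<circ> chart_inv c)"
  proof (rule Ck_on_cong[OF o _ Ck_on_holomorphic_compose[OF o assms(3,4)]])
    show "Ck_on k (snd c ` (fst c \<inter> W)) (u \<circ> chart_inv c)"
      using assms(2) c by (simp add: smooth_fun_on_def smooth_on_def)
  qed (use assms(5) f chart_inv_chart[OF c] in auto)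
qed

lemma differentiable_chart:
  assumes "smooth_fun_on A W u" "c \<in> A" "x \<in> fst c" "x \<in> W"
  shows "(u \<circ> chart_inv c) differentiable (at (snd c x))"
    and "(\<lambda>y. frechet_derivative (u \<circ> chart_inv c) (at y) w) differentiable (at (snd c x))"
proof -
  have "Ck_on 2 (snd c ` (fst c \<inter> W)) (u \<circ> chart_inv c)"
    using assms unfolding smooth_fun_on_def smooth_on_def by blast
  then show "(u \<circ> chart_inv c) differentiable (at (snd c x))"
    and "(\<lambda>y. frechet_derivative (u \<circ> chart_inv c) (at y) w) differentiable (at (snd c x))"
    using assms by (auto simp: numeral_2_eq_2)
qed

lemma smooth_fun_on_subset:
  "smooth_fun_on A V f \<Longrightarrow> W \<subseteq> V \<Longrightarrow> smooth_fun_on A W f"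
  unfolding smooth_fun_on_def smooth_on_def by (meson Ck_on_subset image_mono Int_mono order_refl)

text \<open>A smooth function is continuous in every chart. The result provides the openness of the
  domain \<open>W\<close> of \<open>\<Phi>\<close>.\<close>

lemma openin_preimage_smooth_fun:
  assumes "smooth_fun_on A (topspace M) f" "open T"
  shows "openin M {x \<in> topspace M. f x \<in> T}"
proof (rule openin_if_open_in_charts)
  fix c assume c: "c \<in> A"
  have sub: "fst c \<subseteq> topspace M"
    using chart_domain[OF c] openin_subset by blast
  then have "smooth_on (chart_image c) (f \<circ> chart_inv c)"
    using assms(1) c unfolding smooth_fun_on_def chart_image_def by (metis Int_absorb2)
  then have "continuous_on (chart_image c) (f \<circ> chart_inv c)"
    using Ck_on_imp_continuous_on smooth_on_def by blast
  then have "open (chart_image c \<inter> (f \<circ> chart_inv c) -` T)"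
    using continuous_open_preimage chart_open[OF c] assms(2) by blast
  also have "chart_image c \<inter> (f \<circ> chart_inv c) -` T = snd c ` (fst c \<inter> {x \<in> topspace M. f x \<in> T})"
    using sub by (auto simp: chart_image_def chart_inv_chart[OF c])
  finally show "open (snd c ` (fst c \<inter> {x \<in> topspace M. f x \<in> T}))" .
qed auto

lemma coord_deriv_cong:
  assumes "openin M W" "c \<in> A" "x \<in> fst c" "x \<in> W" "\<And>q. q \<in> fst c \<inter> W \<Longrightarrow> f q = h q"
  shows "coord_deriv c i f x = coord_deriv c i h x"
  unfolding coord_deriv_def
  by (rule fun_cong[OF frechet_derivative_cong_open[OF open_chart_image_Int[OF assms(2,1)]]])
    (use assms chart_inv_chart[OF assms(2)] in auto)

lemma coord_deriv_holomorphic_compose: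
  assumes "openin M W" "smooth_fun_on A W u" "F holomorphic_on T" "open T" "u ` W \<subseteq> T"
    and c: "c \<in> A" "x \<in> fst c" "x \<in> W"
  shows "coord_deriv c i (\<lambda>q. F (u q)) x = deriv F (u x) * coord_deriv c i u x"
  using frechet_derivative_holomorphic_compose(2)[OF assms(3,4) _ differentiable_chart(1)[OF assms(2) c]]
    assms(5) c chart_inv_chart[OF c(1,2)]
  by (auto simp: coord_deriv_def o_def image_subset_iff)

end

section \<open>Gradient, conformality operator and tension field of a holomorphic function of
  \<open>u\<close>\<close>

context semi_riemannian_manifold
begin

text \<open>Nondegeneracy says that the transpose of the component matrix has trivial
  kernel.\<close>

lemma invertible_metric:
  assumes "c \<in> A" "x \<in> fst c"
  shows "invertible (g c x)"
proof -
  have "u = 0" if "transpose (g c x) *v u = 0" for u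
  proof (rule metric_nondegenerate[OF assms])
    show "\<forall>v. u \<bullet> (g c x *v v) = 0"
      using that by (simp add: dot_lmul_matrix[symmetric])
  qed
  then show ?thesis
    unfolding invertible_def
    by (metis matrix_left_invertible_ker left_invertible_transpose matrix_left_right_inverse)
qed

text \<open>Agreement of \<open>f\<close> with \<open>F(u)\<close> is asked on \<open>W\<close>
  only, since the iterates of the tension field are known just there; as \<open>W\<close> is open,
  this determines the derivatives.\<close>

lemma gradient_holomorphic_compose:
  assumes "openin M W" "smooth_fun_on A W u" "F holomorphic_on T" "open T" "u ` W \<subseteq> T"
    and f: "\<And>x. x \<in> W \<Longrightarrow> f x = F (u x)"
    and c: "c \<in> A" "x \<in> fst c" "x \<in> W"
  shows "gradient g c f x = (\<chi> i. deriv F (u x) * gradient g c u x $ i)"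
proof -
  have "coord_deriv c i f x = deriv F (u x) * coord_deriv c i u x" for i
    using coord_deriv_cong[OF assms(1) c, of f "\<lambda>q. F (u q)" i] f
      coord_deriv_holomorphic_compose[OF assms(1-5) c, of i] by auto
  then show ?thesis
    by (simp add: gradient_def sum_distrib_left mult_ac)
qed

text \<open>Prepares the product rule in the divergence of \<open>F'(u) \<nabla>u\<close>: the
  inverse metric is differentiable by Cramer's rule, the partial derivatives of \<open>u\<close>
  because \<open>u\<close> is of class \<open>C\<^sup>2\<close>.\<close>

lemma differentiable_gradient:
  assumes W: "openin M W" "smooth_fun_on A W u" and c: "c \<in> A" "x \<in> fst c" "x \<in> W"
  shows "(\<lambda>y. gradient g c u (chart_inv c y) $ i) differentiable (at (snd c x))"
proof -
  let ?S = "snd c ` (fst c \<inter> W)"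
  have x: "snd c x \<in> ?S" using c by auto
  have S: "chart_inv c y \<in> fst c" "snd c (chart_inv c y) = y" if "y \<in> ?S" for y
    using that chart_inv_chart[OF c(1)] by auto
  have "Ck_on 1 (chart_image c) (g c \<circ> chart_inv c)"
    using metric_smooth[OF c(1)] by (simp add: smooth_on_def)
  then have "(g c \<circ> chart_inv c) differentiable (at (snd c x))"
    using c by (auto simp: chart_image_def)
  then obtain D where D: "((\<lambda>y. g c (chart_inv c y)) has_derivative D) (at (snd c x))"
    by (auto simp: differentiable_def o_def)
  have "(\<lambda>y. g c (chart_inv c y) $ r $ s) differentiable (at (snd c x))" for r s
    using bounded_linear.has_derivative[OF bounded_linear_vec_nth
        bounded_linear.has_derivative[OF bounded_linear_vec_nth D], of r s]
    by (rule differentiableI)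
  then have "(\<lambda>y. matrix_inv (g c (chart_inv c y)) $ i $ j) differentiable (at (snd c x))" for j
    using invertible_metric[OF c(1)] S
    by (intro differentiable_matrix_inv[OF open_chart_image_Int[OF c(1) W(1)] x]) auto
  then have "(\<lambda>y. complex_of_real (matrix_inv (g c (chart_inv c y)) $ i $ j)) differentiable (at (snd c x))" for j
    by (metis bounded_linear.has_derivative bounded_linear_of_real differentiable_def)
  then have "(\<lambda>y. \<Sum>j\<in>UNIV. of_real (matrix_inv (g c (chart_inv c y)) $ i $ j)
      * frechet_derivative (u \<circ> chart_inv c) (at y) (axis j 1)) differentiable (at (snd c x))"
    using differentiable_chart(2)[OF W(2) c]
    by (intro differentiable_sum ballI differentiable_mult) auto
  then show ?thesis
    by (rule differentiable_cong_open[OF open_chart_image_Int[OF c(1) W(1)] x, rotated])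
      (use S in \<open>auto simp: gradient_def coord_deriv_def\<close>)
qed

text \<open>The metric cancels against the inverse metric in the second gradient, which leaves the
  derivative of \<open>h\<close> along the gradient of \<open>f\<close>. In this shape \<kappa>
  comes out of the divergence of a product.\<close>

lemma metric_bilinear_gradient:
  assumes c: "c \<in> A" "x \<in> fst c"
  shows "metric_bilinear (g c x) (gradient g c f x) (gradient g c h x)
    = (\<Sum>i\<in>UNIV. gradient g c f x $ i * coord_deriv c i h x)"
proof -
  let ?I = "matrix_inv (g c x)"
  have id: "(\<Sum>j\<in>UNIV. g c x $ i $ j * ?I $ j $ k) = (if i = k then 1 else 0)" for i k
    using arg_cong[OF matrix_mult_matrix_inv[OF invertible_metric[OF c]], of "\<lambda>m. m $ i $ k"]
    by (simp add: matrix_matrix_mult_def mat_def)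
  have "(\<Sum>j\<in>UNIV. of_real (g c x $ i $ j) * gradient g c h x $ j) = coord_deriv c i h x" for i
  proof -
    have "(\<Sum>j\<in>UNIV. of_real (g c x $ i $ j) * gradient g c h x $ j)
       = (\<Sum>k\<in>UNIV. \<Sum>j\<in>UNIV. of_real (g c x $ i $ j) * (of_real (?I $ j $ k) * coord_deriv c k h x))"
      by (subst sum.swap) (simp add: gradient_def sum_distrib_left)
    also have "\<dots> = (\<Sum>k\<in>UNIV. of_real (\<Sum>j\<in>UNIV. g c x $ i $ j * ?I $ j $ k) * coord_deriv c k h x)"
      by (simp add: sum_distrib_right mult.assoc)
    also have "\<dots> = coord_deriv c i h x"
      by (simp add: id if_distrib[of of_real] if_distrib[of "\<lambda>z. z * _"] cong: if_cong)
    finally show ?thesis .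
  qed
  then show ?thesis
    unfolding metric_bilinear_def
    by (intro sum.cong refl) (simp flip: sum_distrib_left add: mult.assoc mult.left_commute[of "of_real _"])
qed

lemma conformality_holomorphic_compose:
  assumes "openin M W" "smooth_fun_on A W u" "F holomorphic_on T" "open T" "u ` W \<subseteq> T"
    and f: "\<And>x. x \<in> W \<Longrightarrow> f x = F (u x)" and x: "x \<in> W"
  shows "conformality A g f f x = (deriv F (u x))\<^sup>2 * conformality A g u u x"
proof -
  have "chart_at A x \<in> A" "x \<in> fst (chart_at A x)"
    using chart_at openin_subset[OF assms(1)] x by auto
  from gradient_holomorphic_compose[OF assms(1-5) f this x] show ?thesis
    by (simp add: conformality_def Let_def metric_bilinear_def sum_distrib_left power2_eq_square mult_ac)
qed

text \<open>The gradient of \<open>f\<close> is \<open>F'(u) \<nabla>u\<close>. In its divergence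
  the Christoffel terms merely acquire the factor \<open>F'(u)\<close>, while differentiating that
  factor along \<open>\<nabla>u\<close> produces \<open>F''(u)\<close> times \<kappa>.\<close>

lemma tension_holomorphic_compose:
  assumes W: "openin M W" "smooth_fun_on A W u"
    and F: "F holomorphic_on T" "open T" "u ` W \<subseteq> T"
    and f: "\<And>x. x \<in> W \<Longrightarrow> f x = F (u x)" and x: "x \<in> W"
  shows "tension A g f x
    = deriv F (u x) * tension A g u x + deriv (deriv F) (u x) * conformality A g u u x"
proof -
  define c where "c = chart_at A x"
  have c: "c \<in> A" "x \<in> fst c"
    using chart_at openin_subset[OF W(1)] x by (auto simp: c_def)
  have F': "deriv F holomorphic_on T"
    using F by (simp add: holomorphic_deriv)
  have dF: "(\<lambda>y. deriv F (u (chart_inv c y))) differentiable (at (snd c x))"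
    using frechet_derivative_holomorphic_compose(1)[OF F' F(2) _ differentiable_chart(1)[OF W(2) c x]]
      F(3) x chart_inv_chart[OF c] by (auto simp: o_def image_subset_iff)
  have *: "coord_deriv c i (\<lambda>q. gradient g c f q $ i) x
      = deriv F (u x) * coord_deriv c i (\<lambda>q. gradient g c u q $ i) x
        + deriv (deriv F) (u x) * (gradient g c u x $ i * coord_deriv c i u x)" for i
  proof -
    have "coord_deriv c i (\<lambda>q. gradient g c f q $ i) x
        = coord_deriv c i (\<lambda>q. deriv F (u q) * gradient g c u q $ i) x"
      by (rule coord_deriv_cong[OF W(1) c x])
        (use gradient_holomorphic_compose[OF W F f] c in auto)
    also have "\<dots> = deriv F (u x) * coord_deriv c i (\<lambda>q. gradient g c u q $ i) x
        + coord_deriv c i (\<lambda>q. deriv F (u q)) x * gradient g c u x $ i"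
      using fun_cong[OF frechet_derivative_at[OF has_derivative_mult[OF
          dF[unfolded frechet_derivative_works]
          differentiable_gradient[OF W c x, of i, unfolded frechet_derivative_works]]], of "axis i 1"]
      by (simp add: coord_deriv_def o_def chart_inv_chart[OF c])
    finally show ?thesis
      using coord_deriv_holomorphic_compose[OF W F' F(2,3) c x, of i] by (simp add: mult_ac)
  qed
  show ?thesis
    unfolding tension_def conformality_def Let_def c_def[symmetric] metric_bilinear_gradient[OF c]
      divergence_def *
    by (simp add: gradient_holomorphic_compose[OF W F f c x] sum_distrib_left distrib_left
        sum.distrib mult_ac)
qed

text \<open>The conformality operator of the constant \<open>C\<close> is computed twice, once with
  \<open>C\<close> as \<open>F(u)\<close> and once as a constant function of \<open>u\<close>; the
  second value is zero.\<close>

lemma deriv_eq_0_if_compose_constant: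
  assumes "openin M W" "smooth_fun_on A W u" "F holomorphic_on T" "open T" "u ` W \<subseteq> T"
    and const: "\<And>x. x \<in> W \<Longrightarrow> F (u x) = C"
    and x: "x \<in> W" "conformality A g u u x \<noteq> 0"
  shows "deriv F (u x) = 0"
proof -
  have "conformality A g (\<lambda>_. C) (\<lambda>_. C) x = (deriv F (u x))\<^sup>2 * conformality A g u u x"
    by (rule conformality_holomorphic_compose[OF assms(1-5) _ x(1)]) (simp add: const)
  moreover have "conformality A g (\<lambda>_. C) (\<lambda>_. C) x = (deriv (\<lambda>_. C) (u x))\<^sup>2 * conformality A g u u x"
    by (rule conformality_holomorphic_compose[OF assms(1,2) _ assms(4,5) _ x(1)]) auto
  ultimately show ?thesis
    using x(2) by simp
qed

end

section \<open>Iterating the tension field on exponential polynomials\<close>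

text \<open>The action of the tension field on polynomials in \<open>u\<close> when
  \<open>\<kappa>(u,u) = \<beta>\<close> and \<open>\<tau>(u) = \<gamma>\<close> are
  constant.\<close>

definition diff_op :: "complex \<Rightarrow> complex \<Rightarrow> complex poly \<Rightarrow> complex poly" where
  "diff_op \<beta> \<gamma> P = smult \<gamma> (pderiv P) + smult \<beta> (pderiv (pderiv P))"

lemma funpow_diff_op_0: "(diff_op \<beta> \<gamma> ^^ k) 0 = 0"
  by (induction k) (auto simp: diff_op_def)

text \<open>Each application lowers the degree bound by one, and the new top coefficient comes from
  the first-order term alone, as the second-order term lowers the degree by two.\<close>

lemma funpow_diff_op:
  "degree P \<le> k \<Longrightarrow> (diff_op \<beta> \<gamma> ^^ k) P = [:fact k * \<gamma> ^ k * coeff P k:]"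
proof (induction k arbitrary: P)
  case 0
  then show ?case by (auto elim: degree_eq_zeroE)
next
  case (Suc k)
  have "degree (diff_op \<beta> \<gamma> P) \<le> k"
    unfolding diff_op_def using Suc.prems
    by (intro degree_add_le order_trans[OF degree_smult_le]) (auto simp: degree_pderiv)
  moreover have "coeff (diff_op \<beta> \<gamma> P) k = \<gamma> * of_nat (Suc k) * coeff P (Suc k)"
    using Suc.prems by (simp add: diff_op_def coeff_pderiv coeff_eq_0)
  ultimately show ?case
    by (simp add: funpow_Suc_right Suc.IH mult_ac del: funpow.simps of_nat_Suc)
qed

lemma funpow_Suc_diff_op:
  "degree P \<le> k \<Longrightarrow> (diff_op \<beta> \<gamma> ^^ Suc k) P = 0"
  by (simp add: funpow_diff_op) (simp add: diff_op_def pderiv_pCons)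

text \<open>Without first-order term each step costs two degrees, whence the exponents
  \<open>2 * p - 1\<close> and \<open>2 * p - 2\<close> in the case
  \<open>lam = \<mu>\<close>.\<close>

lemma funpow_diff_op_no_drift:
  "(diff_op \<beta> 0 ^^ k) P = smult (\<beta> ^ k) ((pderiv ^^ (2 * k)) P)"
  by (induction k) (auto simp: diff_op_def pderiv_smult)

lemma higher_pderiv_add_monom:
  "(pderiv ^^ k) (monom c (Suc k) + monom d k) = [:fact k * d, fact (Suc k) * c :: complex:]"
proof (induction k arbitrary: c d)
  case 0
  then show ?case by (simp add: monom_Suc monom_0)
next
  case (Suc k)
  then show ?case
    by (simp add: funpow_Suc_right pderiv_add pderiv_monom algebra_simps del: funpow.simps)
qed

lemma deriv_exp_poly:
  fixes a :: complex
  shows "deriv (\<lambda>z. exp (a * z) * poly P z + poly Q z)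
    = (\<lambda>z. exp (a * z) * poly (smult a P + pderiv P) z + poly (pderiv Q) z)"
  by (rule ext, rule DERIV_imp_deriv)
    (auto intro!: derivative_eq_intros poly_DERIV simp: algebra_simps)

lemma holomorphic_poly: "poly P holomorphic_on S"
  unfolding holomorphic_on_def field_differentiable_def using poly_DERIV DERIV_subset by blast

lemma holomorphic_exp_poly: "(\<lambda>z. exp (a * z) * poly P z + poly Q z) holomorphic_on S"
  by (intro holomorphic_poly holomorphic_intros)

context semi_riemannian_manifold
begin

text \<open>Moving \<open>\<beta> D\<^sup>2 + \<gamma> D\<close> past \<open>exp(a z)\<close>
  changes the first-order coefficient to \<open>2 * a * \<beta> + \<gamma>\<close> and adds the
  zero-order coefficient \<open>a * (a * \<beta> + \<gamma>)\<close>, which the assumption on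
  \<open>a\<close> removes.\<close>

lemma funpow_tension_exp_poly:
  assumes W: "openin M W" "smooth_fun_on A W u"
    and \<gamma>: "\<And>x. x \<in> W \<Longrightarrow> tension A g u x = \<gamma>"
    and \<beta>: "\<And>x. x \<in> W \<Longrightarrow> conformality A g u u x = \<beta>"
    and a: "a * (a * \<beta> + \<gamma>) = 0"
    and f: "\<And>x. x \<in> W \<Longrightarrow> f x = exp (a * u x) * poly P (u x) + poly Q (u x)"
    and x: "x \<in> W"
  shows "(tension A g ^^ k) f x = exp (a * u x) * poly ((diff_op \<beta> (2 * a * \<beta> + \<gamma>) ^^ k) P) (u x)
    + poly ((diff_op \<beta> \<gamma> ^^ k) Q) (u x)"
  using x
\<comment> \<open>The next application differentiates the iterate, so its formula must be known
  throughout \<open>W\<close>, not just at one point.\<close>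
proof (induction k arbitrary: x)
  case 0
  then show ?case by (simp add: f)
next
  case (Suc k)
  define P' where "P' = (diff_op \<beta> (2 * a * \<beta> + \<gamma>) ^^ k) P"
  define Q' where "Q' = (diff_op \<beta> \<gamma> ^^ k) Q"
  let ?F = "\<lambda>z. exp (a * z) * poly P' z + poly Q' z"
  have "tension A g ((tension A g ^^ k) f) x = deriv ?F (u x) * \<gamma> + deriv (deriv ?F) (u x) * \<beta>"
    using tension_holomorphic_compose[OF W holomorphic_exp_poly open_UNIV subset_UNIV,
        of "(tension A g ^^ k) f" a P' Q' x] Suc \<gamma> \<beta>
    by (simp add: P'_def Q'_def)
  also have "\<dots> = exp (a * u x) * poly (diff_op \<beta> (2 * a * \<beta> + \<gamma>) P') (u x)
      + poly (diff_op \<beta> \<gamma> Q') (u x) + (a * (a * \<beta> + \<gamma>)) * (exp (a * u x) * poly P' (u x))"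
    unfolding deriv_exp_poly by (simp add: diff_op_def pderiv_add pderiv_smult algebra_simps)
  finally show ?case
    by (simp add: a P'_def Q'_def)
qed

end

section \<open>The logarithm of \<open>\<phi>\<close> and the three cases of the theorem\<close>

lemma deriv_Ln:
  assumes "z \<notin> \<real>\<^sub>\<le>\<^sub>0"
  shows "deriv Ln z = 1 / z" "deriv (deriv Ln) z = - (1 / z\<^sup>2)"
proof -
  have *: "deriv Ln w = 1 / w" if "w \<in> - \<real>\<^sub>\<le>\<^sub>0" for w
    using that by (intro DERIV_imp_deriv) (auto intro!: derivative_eq_intros simp: divide_inverse)
  show "deriv Ln z = 1 / z"
    using * assms by simp
  have "((\<lambda>w. 1 / w) has_field_derivative - (1 / z\<^sup>2)) (at z)"
    using assms by (auto intro!: derivative_eq_intros simp: power2_eq_square)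
  then have "(deriv Ln has_field_derivative - (1 / z\<^sup>2)) (at z)"
    by (rule has_field_derivative_transform_within_open[of _ _ _ "- \<real>\<^sub>\<le>\<^sub>0"])
      (use assms * in auto)
  then show "deriv (deriv Ln) z = - (1 / z\<^sup>2)"
    by (rule DERIV_imp_deriv)
qed

text \<open>For \<open>\<mu> = 0\<close> only \<open>c1\<close> enters the formula, so it must be
  nonzero itself. Non-vanishing means not identically zero: for \<open>p > 1\<close> the powers of
  the logarithm may have zeros, for instance where \<open>\<phi> x = 1\<close>.\<close>

theorem theorem3p2:
  fixes M :: "'a topology"
    and A :: "('a, 'n::finite) chart set"
    and g :: "('a, 'n) metric"
    and \<phi> \<Phi> :: "'a \<Rightarrow> complex"
    and lam \<mu> c1 c2 :: complex
    and W :: "'a set"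
    and p :: nat
  assumes manifold: "semi_riemannian_manifold M A g"
    and smooth: "smooth_fun_on A (topspace M) \<phi>"
    and nonzero: "(lam, \<mu>) \<noteq> (0, 0)"
    and tension: "\<And>x. x \<in> topspace M \<Longrightarrow> tension A g \<phi> x = lam * \<phi> x"
    and conformality: "\<And>x. x \<in> topspace M \<Longrightarrow> conformality A g \<phi> \<phi> x = \<mu> * (\<phi> x)^2"
    and p: "p > 0"
    and W: "W = {x \<in> topspace M. \<phi> x \<notin> \<real>\<^sub>\<le>\<^sub>0}"
    and W_nonempty: "W \<noteq> {}"
    and coefficients: "(c1, c2) \<noteq> (0, 0)" "\<mu> = 0 \<Longrightarrow> c1 \<noteq> 0"
    and Phi: "\<And>x. x \<in> W \<Longrightarrow> \<Phi> x =
      (if \<mu> = 0 then c1 * Ln (\<phi> x) ^ (p - 1)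
       else if lam = \<mu> then c1 * Ln (\<phi> x) ^ (2 * p - 1) + c2 * Ln (\<phi> x) ^ (2 * p - 2)
       else c1 * (\<phi> x powr (1 - lam / \<mu>)) * Ln (\<phi> x) ^ (p - 1) + c2 * Ln (\<phi> x) ^ (p - 1))"
  shows "(\<exists>x\<in>W. \<Phi> x \<noteq> 0) \<and> proper_p_harmonic_on A g W p \<Phi>"
proof -
  interpret semi_riemannian_manifold M A g by (fact manifold)
  obtain n where n: "p = Suc n"
    using p gr0_implies_Suc by blast
  define u where "u = (\<lambda>x. Ln (\<phi> x))"
  let ?T = "- \<real>\<^sub>\<le>\<^sub>0 :: complex set"
  have T: "Ln holomorphic_on ?T" "open ?T" "\<phi> ` W \<subseteq> ?T"
    by (auto simp: W intro!: holomorphic_intros)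
  have W_open: "openin M W"
    using openin_preimage_smooth_fun[OF smooth T(2)] by (simp add: W)
  have \<phi>: "smooth_fun_on A W \<phi>"
    using smooth_fun_on_subset[OF smooth] by (auto simp: W)
  have u: "smooth_fun_on A W u"
    by (rule smooth_fun_on_holomorphic_compose[OF W_open \<phi> T]) (simp add: u_def)
  have \<phi>_nz: "\<phi> x \<noteq> 0" "\<phi> x \<notin> \<real>\<^sub>\<le>\<^sub>0" "x \<in> topspace M" if "x \<in> W" for x
    using that by (auto simp: W)
  have \<gamma>: "tension A g u x = lam - \<mu>" if "x \<in> W" for x
    using tension_holomorphic_compose[OF W_open \<phi> T _ that, of u] \<phi>_nz[OF that]
    by (simp add: u_def tension conformality deriv_Ln field_simps)
  have \<beta>: "conformality A g u u x = \<mu>" if "x \<in> W" for x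
    using conformality_holomorphic_compose[OF W_open \<phi> T _ that, of u] \<phi>_nz[OF that]
    by (simp add: u_def conformality deriv_Ln field_simps)

  \<comment> \<open>If \<open>F(u)\<close> vanished on all of \<open>W\<close>, then at any point of
    \<open>W\<close> both \<open>F\<close> and its derivative would vanish at \<open>u x\<close>,
    which functions with only simple zeros exclude.\<close>
  have nonvanishing: "\<exists>x\<in>W. F (u x) \<noteq> 0"
    if "F holomorphic_on UNIV" "\<mu> \<noteq> 0" "\<And>z. F z = 0 \<Longrightarrow> deriv F z \<noteq> 0" for F
    using deriv_eq_0_if_compose_constant[OF W_open u that(1), of 0] \<beta> that W_nonempty by fastforce

  \<comment> \<open>The common form of the three cases: \<open>p\<close> steps annihilate both
    polynomials, but what \<open>n = p - 1\<close> steps leave is not identically zero.\<close>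
  obtain a P Q where a: "a * (a * \<mu> + (lam - \<mu>)) = 0"
    and \<Phi>: "\<And>x. x \<in> W \<Longrightarrow> \<Phi> x = exp (a * u x) * poly P (u x) + poly Q (u x)"
    and P: "(diff_op \<mu> (2 * a * \<mu> + (lam - \<mu>)) ^^ p) P = 0"
    and Q: "(diff_op \<mu> (lam - \<mu>) ^^ p) Q = 0"
    and nz: "\<exists>x\<in>W. exp (a * u x) * poly ((diff_op \<mu> (2 * a * \<mu> + (lam - \<mu>)) ^^ n) P) (u x)
      + poly ((diff_op \<mu> (lam - \<mu>) ^^ n) Q) (u x) \<noteq> 0"
  proof (cases "\<mu> = 0")
    case True
    have deg: "degree (monom c1 n) \<le> n"
      by (rule degree_monom_le)
    \<comment> \<open>Here \<open>lam \<noteq> 0\<close> and the operator is \<open>lam * D\<close>;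
      the \<open>n\<close>-th step leaves the nonzero constant \<open>fact n * lam ^ n * c1\<close>.
      The exponential part is void.\<close>
    show ?thesis
      by (rule that[of 0 0 "monom c1 n"])
        (use True nonzero coefficients W_nonempty funpow_diff_op[OF deg] funpow_Suc_diff_op[OF deg]
          in \<open>auto simp: Phi n u_def poly_monom funpow_diff_op_0 simp del: funpow.simps\<close>)
  next
    case \<mu>: False
    show ?thesis
    proof (cases "lam = \<mu>")
      case True
      \<comment> \<open>With \<open>p = n + 1\<close> the exponents are \<open>2 * n + 1\<close> and
        \<open>2 * n\<close>; applying \<open>\<mu> D\<^sup>2\<close> \<open>n\<close> times leaves
        a polynomial of degree at most one.\<close>
      define Q where "Q = monom c1 (2 * n + 1) + monom c2 (2 * n)"
      have "(pderiv ^^ (2 * n)) Q = [:fact (2 * n) * c2, fact (Suc (2 * n)) * c1:]"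
        unfolding Q_def Suc_eq_plus1[symmetric] by (rule higher_pderiv_add_monom)
      then have "(diff_op \<mu> 0 ^^ n) Q = [:\<mu> ^ n * (fact (2 * n) * c2), \<mu> ^ n * (fact (Suc (2 * n)) * c1):]"
        by (simp add: funpow_diff_op_no_drift)
      then obtain k1 k2 where k: "(diff_op \<mu> 0 ^^ n) Q = [:k2, k1:]" "(k1, k2) \<noteq> (0, 0)"
        using \<mu> coefficients fact_nonzero[of "Suc (2 * n)"] by (auto simp del: fact_Suc)
      have deriv: "deriv (poly [:k2, k1:]) z = k1" for z
        by (rule trans[OF DERIV_imp_deriv[OF poly_DERIV]]) (simp add: pderiv_pCons)
      have "\<exists>x\<in>W. poly [:k2, k1:] (u x) \<noteq> 0"
      proof (rule nonvanishing[OF holomorphic_poly \<mu>])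
        show "deriv (poly [:k2, k1:]) z \<noteq> 0" if "poly [:k2, k1:] z = 0" for z
          \<comment> \<open>At a zero, \<open>k1 = 0\<close> would force \<open>k2 = 0\<close> as
            well.\<close>
          using that k(2) unfolding deriv by auto
      qed
      moreover have "(diff_op \<mu> 0 ^^ p) Q = 0"
        by (simp add: n k) (simp add: diff_op_def pderiv_pCons)
      moreover have poly_Q: "poly Q z = c1 * z ^ (2 * n + 1) + c2 * z ^ (2 * n)" for z
        by (simp add: Q_def poly_monom)
      ultimately show ?thesis
        using \<mu> True
        by (intro that[of 0 0 Q])
          (auto simp: Phi n k u_def poly_Q funpow_diff_op_0 simp del: funpow.simps)
    next
      case False
      \<comment> \<open>The nonzero root of \<open>a * (a * \<mu> + (lam - \<mu>))\<close>; the
        power of \<open>\<phi>\<close> in the third case is \<open>exp (a * u x)\<close>.\<close>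
      define a where "a = 1 - lam / \<mu>"
      have a: "a * \<mu> = \<mu> - lam" "a \<noteq> 0"
        using \<mu> False by (auto simp: a_def field_simps)
      \<comment> \<open>The constants to which \<open>n\<close> steps reduce the two monomials; the
        drifts of the two parts are opposite and nonzero.\<close>
      define k1 k2 where "k1 = fact n * (\<mu> - lam) ^ n * c1" and "k2 = fact n * (lam - \<mu>) ^ n * c2"
      have k: "(k1, k2) \<noteq> (0, 0)"
        using coefficients False by (auto simp: k1_def k2_def)
      have deg: "degree (monom c n) \<le> n" for c :: complex
        by (rule degree_monom_le)
      have drift: "2 * a * \<mu> + (lam - \<mu>) = \<mu> - lam"
        by (simp add: mult.assoc a(1))
      have "\<exists>x\<in>W. exp (a * u x) * poly [:k1:] (u x) + poly [:k2:] (u x) \<noteq> 0"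
      proof (rule nonvanishing[OF holomorphic_exp_poly \<mu>])
        fix z
        assume "exp (a * z) * poly [:k1:] z + poly [:k2:] z = 0"
        \<comment> \<open>If \<open>k1 = 0\<close>, the equation gives \<open>k2 = 0\<close>. The
          derivative is \<open>a * k1 * exp (a * z)\<close>, hence nonzero.\<close>
        then have "k1 \<noteq> 0"
          using k by auto
        then show "deriv (\<lambda>z. exp (a * z) * poly [:k1:] z + poly [:k2:] z) z \<noteq> 0"
          unfolding deriv_exp_poly using a(2) by (simp add: pderiv_pCons)
      qed
      then show ?thesis
        using \<mu> False a \<phi>_nz(1)
        by (intro that[of a "monom c1 n" "monom c2 n"])
          (auto simp: Phi drift n u_def a_def[symmetric] k1_def k2_def poly_monom powr_def
            funpow_diff_op[OF deg] funpow_Suc_diff_op[OF deg] simp del: funpow.simps)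
    qed
  qed
  note iterate = funpow_tension_exp_poly[OF W_open u \<gamma> \<beta> a \<Phi>]
  have "smooth_fun_on A W \<Phi>"
    by (rule smooth_fun_on_holomorphic_compose[OF W_open u holomorphic_exp_poly open_UNIV subset_UNIV \<Phi>])
  \<comment> \<open>If \<open>\<Phi>\<close> were zero on \<open>W\<close>, it would be represented
    by \<open>P = Q = 0\<close>, and its \<open>n\<close>-th iterate would vanish on
    \<open>W\<close>, contrary to \<open>nz\<close>.\<close>
  moreover have "\<exists>x\<in>W. \<Phi> x \<noteq> 0"
    using funpow_tension_exp_poly[OF W_open u \<gamma> \<beta> a, of \<Phi> 0 0 _ n] iterate[of _ n] nz
    by (auto simp: funpow_diff_op_0)
  ultimately show ?thesis
    unfolding proper_p_harmonic_on_def using iterate nz P Q by (simp add: n del: funpow.simps)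
qed

end
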